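(* Assume the Continuum Hypothesis. For every selective ultrafilter $\mathcal U$ on $\mathbb N$ there is a non-selective but quasi-selective ultrafilter $\mathcal V$ on $\mathbb N$ above $\mathcal U$ in the Rudin–Keisler ordering. Furthermore, $\mathcal V$ can be chosen to satisfy the partition relation $\mathbb N\to[\mathcal V]^2_3$.
   Context: $\mathbb N=\{0,1,2,\dots\}$. A nonprincipal ultrafilter $\mathcal U$ on $\mathbb N$ is selective if every $f:\mathbb N\to\mathbb N$ agrees on a set in $\mathcal U$ with a nondecreasing function; quasi-selective if this holds for every $f$ with $f(n)\le n$ for all $n$. $\mathcal V$ is above $\mathcal U$ in the Rudin–Keisler ordering if $\mathcal U=f(\mathcal V)=\{B: f^{-1}(B)\in\mathcal V\}$ for some $f:\mathbb N\to\mathbb N$. $\mathbb N\to[\mathcal V]^2_3$ means: for every partition of $[\mathbb N]^2$ (the two-element subsets of $\mathbb N$) into 3 pieces there is $H\in\mathcal V$ such that $[H]^2$ meets at most 2 of the pieces. *)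

theory Defs
  imports "HOL-Library.Ramsey" "HOL-Library.Disjoint_Sets"
begin

text \<open>
  An ultrafilter on \<open>\<nat>\<close> is represented as a \<^typ>\<open>nat filter\<close>; its members are the sets
  \<open>A\<close> with \<open>\<forall>\<^sub>F n in U. n \<in> A\<close>.  Note that \<^typ>\<open>nat filter\<close> includes the improper
  filter \<^term>\<open>bot\<close>, which has to be excluded.
\<close>

definition ultrafilter :: "'a filter \<Rightarrow> bool" where
  "ultrafilter U \<longleftrightarrow>
     U \<noteq> bot \<and> (\<forall>A. (\<forall>\<^sub>F x in U. x \<in> A) \<or> (\<forall>\<^sub>F x in U. x \<notin> A))"

definition nonprincipal_ultrafilter :: "'a filter \<Rightarrow> bool" where
  "nonprincipal_ultrafilter U \<longleftrightarrow> ultrafilter U \<and> (\<forall>x. U \<noteq> principal {x})"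

definition selective :: "nat filter \<Rightarrow> bool" where
  "selective U \<longleftrightarrow>
     nonprincipal_ultrafilter U \<and>
     (\<forall>f :: nat \<Rightarrow> nat. \<exists>g :: nat \<Rightarrow> nat. mono g \<and> (\<forall>\<^sub>F n in U. f n = g n))"

definition quasi_selective :: "nat filter \<Rightarrow> bool" where
  "quasi_selective U \<longleftrightarrow>
     nonprincipal_ultrafilter U \<and>
     (\<forall>f :: nat \<Rightarrow> nat. (\<forall>n. f n \<le> n) \<longrightarrow>
        (\<exists>g :: nat \<Rightarrow> nat. mono g \<and> (\<forall>\<^sub>F n in U. f n = g n)))"

text \<open>
  The image \<open>f(V) = {B. f -` B \<in> V}\<close> is \<^term>\<open>filtermap f V\<close>.
\<close>

definition rudin_keisler_above :: "nat filter \<Rightarrow> nat filter \<Rightarrow> bool" where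
  "rudin_keisler_above V U \<longleftrightarrow> (\<exists>f :: nat \<Rightarrow> nat. U = filtermap f V)"

text \<open>
  The square-bracket relation \<open>\<nat> \<rightarrow> [V]\<^sup>2\<^sub>3\<close>.  The pieces of the partition are
  \<open>P 0\<close>, \<open>P 1\<close>, \<open>P 2\<close>; empty pieces are allowed, which does not change the relation.
\<close>

definition partition_relation_2_3 :: "nat filter \<Rightarrow> bool" where
  "partition_relation_2_3 V \<longleftrightarrow>
     (\<forall>P :: nat \<Rightarrow> nat set set.
        disjoint_family_on P {..<3} \<and> (\<Union>i<3. P i) = [UNIV]\<^bsup>2\<^esup> \<longrightarrow>
        (\<exists>H. (\<forall>\<^sub>F n in V. n \<in> H) \<and> card {i. i < 3 \<and> [H]\<^bsup>2\<^esup> \<inter> P i \<noteq> {}} \<le> 2))"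

unbundle cardinal_syntax

text \<open>The Continuum Hypothesis as the cardinal equation \<open>2\<^bsup>\<aleph>\<^sub>0\<^esup> = \<aleph>\<^sub>1\<close>.\<close>

definition Continuum_Hypothesis :: bool where
  "Continuum_Hypothesis \<longleftrightarrow> |UNIV :: nat set set| =o cardSuc natLeq"

end

theory Submission
  imports Defs "HOL-Library.Countable_Set_Type"
begin

text \<open>
  Fix finite sets \<open>I n\<close>, far apart from each other, so that \<open>I n\<close> survives \<open>n\<close> successive
  applications of Ramsey's theorem for pairs and still remains relatively large.  Call \<open>X\<close> big if,
  for every \<open>k\<close>, the trace of \<open>X\<close> on \<open>I n\<close> survives \<open>k\<close> applications for \<open>U\<close>-almost all \<open>n\<close>.
  Selectivity of \<open>U\<close> shrinks any big set, for a given 2-colouring of pairs, to a big set on which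
  the colour of a pair depends only on whether its two points lie in the same block.  Countable
  chains of big sets (modulo \<open>U\<close>) have big lower bounds, so under CH a tower of length \<open>\<omega>\<^sub>1\<close> handles
  all 2-colourings, and it generates \<open>V\<close>.  The block index maps \<open>V\<close> to \<open>U\<close> and is not injective on
  any set in \<open>V\<close>.  For \<open>f n \<le> n\<close>, colour \<open>{x < y}\<close> by \<open>f x \<le> f y\<close>: the negative colour
  is impossible within a relatively large trace and impossible across infinitely many blocks, so \<open>f\<close>
  is nondecreasing on a set in \<open>V\<close>.  The two remaining colours, one for pairs inside a block and
  one for pairs across blocks, give the partition relation.
\<close>

section \<open>Ultrafilters on the natural numbers\<close>

lemma ultrafilter_cases:
  assumes "ultrafilter U"
  shows "(\<forall>\<^sub>F x in U. P x) \<or> (\<forall>\<^sub>F x in U. \<not> P x)"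
  using assms[unfolded ultrafilter_def, THEN conjunct2, THEN spec, of "{x. P x}"] by simp

lemma ultrafilter_decides:
  fixes P :: "'a \<Rightarrow> bool"
  assumes "ultrafilter U"
  shows "\<exists>e. \<forall>\<^sub>F x in U. P x = e"
  using ultrafilter_cases[OF assms, of P]
proof
  assume "\<forall>\<^sub>F x in U. P x"
  then show ?thesis
    by (intro exI[of _ True]) simp
next
  assume "\<forall>\<^sub>F x in U. \<not> P x"
  then show ?thesis
    by (intro exI[of _ False]) simp
qed

lemma ultrafilter_eventually_not_iff:
  assumes "ultrafilter U"
  shows "(\<forall>\<^sub>F x in U. \<not> P x) \<longleftrightarrow> \<not> (\<forall>\<^sub>F x in U. P x)"
proof -
  have "U \<noteq> bot"
    using assms by (simp add: ultrafilter_def)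
  then have "\<not> ((\<forall>\<^sub>F x in U. P x) \<and> (\<forall>\<^sub>F x in U. \<not> P x))"
    by (simp flip: eventually_conj_iff)
  then show ?thesis
    using ultrafilter_cases[OF assms, of P] by blast
qed

lemma nonprincipal_ultrafilter_neq:
  assumes "nonprincipal_ultrafilter U"
  shows "\<forall>\<^sub>F x in U. x \<noteq> a"
proof (rule ccontr)
  have U: "ultrafilter U"
    using assms by (simp add: nonprincipal_ultrafilter_def)
  assume "\<not> ?thesis"
  then have a: "\<forall>\<^sub>F x in U. x = a"
    using ultrafilter_eventually_not_iff[OF U, of "\<lambda>x. x = a"] by blast
  have "eventually P U \<longleftrightarrow> P a" for P
  proof -
    have "eventually P U \<longleftrightarrow> (\<forall>\<^sub>F x in U. P a)"
      using a by (intro eventually_subst) (auto elim: eventually_mono)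
    then show ?thesis
      using U by (simp add: eventually_const_iff ultrafilter_def)
  qed
  then have "U = principal {a}"
    by (intro filter_eqI) (simp add: eventually_principal)
  then show False
    using assms by (simp add: nonprincipal_ultrafilter_def)
qed

lemma nonprincipal_ultrafilter_ge:
  fixes U :: "nat filter"
  assumes "nonprincipal_ultrafilter U"
  shows "\<forall>\<^sub>F n in U. k \<le> n"
proof -
  have "\<forall>\<^sub>F n in U. \<forall>a\<in>{..<k}. n \<noteq> a"
    using nonprincipal_ultrafilter_neq[OF assms] by (intro eventually_ball_finite) auto
  then show ?thesis
    by (rule eventually_mono) (use not_less in blast)
qed

text \<open>Selectivity is used twice. First it replaces the bound below which \<open>R _ n\<close>
  holds by a nondecreasing function tending to infinity, so \<open>R m n\<close> holds once
  \<open>n\<close> is far beyond \<open>m\<close>. Then it leaves at most one point in each interval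
  of a sparse partition, and fixing the parity of the interval index keeps these points far
  apart.\<close>

lemma selective_diagonal:
  fixes U :: "nat filter"
  assumes "selective U" and R: "\<And>m. \<forall>\<^sub>F n in U. R m n"
  shows "\<exists>T. (\<forall>\<^sub>F n in U. n \<in> T) \<and> (\<forall>m\<in>T. \<forall>n\<in>T. m < n \<longrightarrow> R m n)"
proof -
  have np: "nonprincipal_ultrafilter U" and U: "ultrafilter U" and ne: "U \<noteq> bot"
    and sel: "\<And>f :: nat \<Rightarrow> nat. \<exists>g :: nat \<Rightarrow> nat. mono g \<and> (\<forall>\<^sub>F n in U. f n = g n)"
    using assms(1) by (auto simp: selective_def nonprincipal_ultrafilter_def ultrafilter_def)
  \<comment> \<open>The alternative \<open>n \<le> m\<close> guarantees that the least
    \<open>m\<close> exists even if \<open>R m n\<close> holds for all \<open>m\<close>.\<close>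
  define \<phi> where "\<phi> n = (LEAST m. \<not> R m n \<or> n \<le> m)" for n
  have R_if: "R m n" if "m < \<phi> n" for m n
    using not_less_Least[of m "\<lambda>m. \<not> R m n \<or> n \<le> m"] that unfolding \<phi>_def by blast
  have \<phi>_gt: "\<forall>\<^sub>F n in U. k < \<phi> n" for k
  proof -
    have "\<forall>\<^sub>F n in U. \<forall>m\<in>{..k}. R m n \<and> m < n"
      using R nonprincipal_ultrafilter_ge[OF np, of "Suc _"]
      by (intro eventually_ball_finite) (auto simp: eventually_conj_iff Suc_le_eq)
    then show ?thesis
    proof (rule eventually_mono)
      fix n assume *: "\<forall>m\<in>{..k}. R m n \<and> m < n"
      have "\<not> R (\<phi> n) n \<or> n \<le> \<phi> n"
        unfolding \<phi>_def by (rule LeastI[of _ n]) simp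
      then show "k < \<phi> n"
        using * by (meson atMost_iff leD not_less)
    qed
  qed
  obtain g where g: "mono g" "\<forall>\<^sub>F n in U. \<phi> n = g n"
    using sel by blast
  \<comment> \<open>Divergence along \<open>U\<close> becomes true divergence: by monotonicity one
    value above \<open>k\<close> bounds all later ones from below.\<close>
  have "\<exists>N. \<forall>n\<ge>N. k < g n" for k
  proof -
    have "\<forall>\<^sub>F n in U. k < g n"
      using g(2) \<phi>_gt[of k] by eventually_elim simp
    then obtain N where "k < g N"
      using eventually_happens ne by blast
    then show ?thesis
      using g(1) by (meson monoD order_less_le_trans)
  qed
  then obtain N where N: "\<And>k n. N k \<le> n \<Longrightarrow> k < g n"
    by metis
  \<comment> \<open>Interval endpoints: from \<open>a (Suc k)\<close> on, \<open>g\<close> exceeds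
    \<open>a k\<close>. The maximum with \<open>b\<close> makes the sequence strictly increasing.
    Below, \<open>q x\<close> is the index of the interval containing \<open>x\<close>.\<close>
  define a where "a = rec_nat 0 (\<lambda>_ b. Suc (max (N b) b))"
  have a_Suc: "a (Suc k) = Suc (max (N (a k)) (a k))" for k
    by (simp add: a_def)
  have a_ge: "k \<le> a k" for k
    by (induction k) (auto simp: a_Suc)
  define q where "q x = (LEAST k. x < a (Suc k))" for x
  have q: "x < a (Suc (q x))" for x
    unfolding q_def by (rule LeastI_ex) (use a_ge[of "Suc x"] in \<open>auto simp: Suc_le_eq\<close>)
  have q_le: "a (Suc j) \<le> x" if "j < q x" for j x
    using not_less_Least[of j "\<lambda>k. x < a (Suc k)"] that unfolding q_def by simp
  have q_mono: "q m \<le> q n" if "m < n" for m n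
    unfolding q_def[of m] by (rule Least_le) (use q[of n] that in simp)
  \<comment> \<open>With a full interval in between,
    \<open>m < a (Suc (q m)) < \<phi> n\<close>.\<close>
  have R_far: "R m n" if "\<phi> n = g n" "q m + 2 \<le> q n" for m n
  proof -
    have "a (Suc (Suc (q m))) \<le> n"
      using q_le[of "Suc (q m)" n] that(2) by simp
    then have "a (Suc (q m)) < \<phi> n"
      using N[of "a (Suc (q m))" n] that(1) a_Suc[of "Suc (q m)"] by simp
    then show ?thesis
      using q[of m] R_if by simp
  qed
  \<comment> \<open>A function that decreases on each block of \<open>q\<close> forces at most one point per block.\<close>
  obtain h where h: "mono h" "\<forall>\<^sub>F n in U. a (Suc (q n)) - n = h n"
    using sel[of "\<lambda>n. a (Suc (q n)) - n"] by blast
  \<comment> \<open>Distinct interval indices of equal parity differ by at least 2, as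
    \<open>R_far\<close> requires.\<close>
  obtain p where p: "\<forall>\<^sub>F n in U. even (q n) = p"
    using ultrafilter_decides[OF U, of "\<lambda>n. even (q n)"] by blast
  let ?T = "{n. \<phi> n = g n \<and> a (Suc (q n)) - n = h n \<and> even (q n) = p}"
  have "\<forall>\<^sub>F n in U. n \<in> ?T"
    using g(2) h(2) p by eventually_elim simp
  moreover have "R m n" if "m \<in> ?T" "n \<in> ?T" "m < n" for m n
  proof (rule R_far)
    show "\<phi> n = g n"
      using that by simp
    have "q m \<noteq> q n"
    proof
      assume "q m = q n"
      then have "h n < h m"
        using that q[of m] q[of n] by auto
      then show False
        using monoD[OF h(1), of m n] that(3) by simp
    qed
    moreover have "even (q m) = even (q n)"
      using that by simp
    ultimately show "q m + 2 \<le> q n"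
      using q_mono[OF that(3)] by presburger
  qed
  ultimately show ?thesis
    by (intro exI[of _ ?T] conjI ballI impI)
qed

section \<open>A Ramsey norm on finite sets\<close>

definition homogeneous :: "('a::order \<Rightarrow> 'a \<Rightarrow> bool) \<Rightarrow> 'a set \<Rightarrow> bool" where
  "homogeneous c B \<longleftrightarrow> (\<exists>e. \<forall>x\<in>B. \<forall>y\<in>B. x < y \<longrightarrow> c x y = e)"

text \<open>
  Relative largeness \<open>Min A + 2 < card A\<close>, as in the Paris--Harrington principle, excludes
  homogeneous sets on which a function \<open>f\<close> with \<open>f n \<le> n\<close> is strictly decreasing.
  The summand \<open>2\<close> makes the pigeonhole argument below work for two classes even if \<open>0 \<in> A\<close>.
\<close>

primrec large :: "nat \<Rightarrow> nat set \<Rightarrow> bool" where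
  "large 0 A \<longleftrightarrow> finite A \<and> A \<noteq> {} \<and> Min A + 2 < card A"
| "large (Suc k) A \<longleftrightarrow> finite A \<and> (\<forall>c. \<exists>B\<subseteq>A. large k B \<and> homogeneous c B)"

lemma large_finite: "large k A \<Longrightarrow> finite A"
  by (cases k) auto

lemma large_superset:
  assumes "large k A" and "A \<subseteq> B" and "finite B"
  shows "large k B"
proof (cases k)
  case 0
  then have A: "A \<noteq> {}" "Min A + 2 < card A"
    using assms(1) by simp_all
  have "Min B \<le> Min A" "card A \<le> card B"
    using A assms(2,3) by (auto intro: Min_antimono card_mono simp del: Min_le_iff)
  with A have "Min B + 2 < card B"
    by linarith
  with A assms(2,3) show ?thesis
    unfolding 0 large.simps by blast
next
  case (Suc j)
  show ?thesis
    using assms unfolding Suc large.simps by (meson subset_trans)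
qed

lemma large_Suc_imp:
  assumes "large (Suc k) A"
  shows "large k A"
  using assms large_superset unfolding large.simps by blast

lemma large_mono: "large k A \<Longrightarrow> j \<le> k \<Longrightarrow> large j A"
  by (induction k) (auto simp del: large.simps simp: le_Suc_eq dest: large_Suc_imp)

lemma large_0: "large k A \<Longrightarrow> A \<noteq> {} \<and> Min A + 2 < card A"
  using large_mono[of k A 0] by simp

text \<open>Ramsey's theorem for triples replaces a compactness argument here.\<close>

lemma infinite_imp_large_subset: "infinite A \<Longrightarrow> \<exists>F\<subseteq>A. large k F"
proof (induction k arbitrary: A)
  case 0
  define a where "a = (LEAST x. x \<in> A)"
  have "\<exists>x. x \<in> A"
    using 0 by (metis ex_in_conv finite.emptyI)
  then have a: "a \<in> A"
    unfolding a_def by (rule LeastI_ex)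
  have a_le: "a \<le> x" if "x \<in> A" for x
    unfolding a_def using that by (rule Least_le)
  obtain F where F: "F \<subseteq> A - {a}" "finite F" "card F = a + 3"
    using 0 infinite_arbitrarily_large[of "A - {a}" "a + 3"] by auto
  have "Min (insert a F) = a"
    using F a_le by (intro Min_eqI) auto
  moreover have "card (insert a F) = a + 4"
    using F by (subst card_insert_disjoint) auto
  ultimately show ?case
    using F a by (intro exI[of _ "insert a F"]) auto
next
  case (Suc k)
  show ?case
  proof (rule ccontr)
    assume no: "\<not> ?case"
    have "\<exists>c :: nat \<Rightarrow> nat \<Rightarrow> bool. \<forall>B\<subseteq>A \<inter> {..<n}. large k B \<longrightarrow>
        \<not> homogeneous c B" for n
    proof -
      have "\<not> large (Suc k) (A \<inter> {..<n})"
        using no by blast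
      moreover have "finite (A \<inter> {..<n})"
        by simp
      ultimately show ?thesis
        unfolding large.simps by blast
    qed
    then obtain c where c: "\<And>n B. B \<subseteq> A \<inter> {..<n} \<Longrightarrow> large k B \<Longrightarrow> \<not> homogeneous (c n) B"
      by metis
    \<comment> \<open>If the claim fails, every \<open>A \<inter> {..<n}\<close> has a bad colouring
      \<open>c n\<close>. A triple \<open>x < y < n\<close> receives the colour of
      \<open>x, y\<close> under \<open>c n\<close>; on a set homogeneous for triples,
      \<open>c n\<close> is then constant on any finite part \<open>F\<close> below a further
      element \<open>n\<close>, so a \<open>k\<close>-large \<open>F\<close> contradicts the badness
      of \<open>c n\<close>.\<close>
    define f where "f X = (if c (Max X) (Min X) (Min (X - {Min X})) then 1 else 0 :: nat)" for X
    have "\<forall>X. X \<subseteq> A \<and> finite X \<and> card X = 3 \<longrightarrow> f X < 2"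
      by (simp add: f_def)
    from Ramsey[OF Suc.prems this] obtain Y t where
      Y: "Y \<subseteq> A" "infinite Y" "\<forall>X. X \<subseteq> Y \<and> finite X \<and> card X = 3 \<longrightarrow> f X = t"
      by (elim exE conjE)
    obtain F where F: "F \<subseteq> Y" "large k F"
      using Suc.IH Y(2) by blast
    obtain n where n: "n \<in> Y" "Max F < n"
      using Y(2) by (meson infinite_nat_iff_unbounded)
    have lt: "x < n" if "x \<in> F" for x
      using that n(2) large_finite[OF F(2)] by (meson Max_ge order_le_less_trans)
    have "c n x y = (t = 1)" if "x \<in> F" "y \<in> F" "x < y" for x y
    proof -
      have "f {x, y, n} = t"
        using that F(1) n(1) lt[of x] lt[of y] by (intro Y(3)[rule_format]) (auto simp: card_insert_if)
      moreover have "Max {x, y, n} = n" "Min {x, y, n} = x"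
        using that lt by (auto intro!: Max_eqI Min_eqI)
      moreover have "{x, y, n} - {x} = {y, n}" "Min {y, n} = y"
        using that lt[of x] lt[of y] by (auto intro!: Min_eqI)
      ultimately show ?thesis
        unfolding f_def by (auto split: if_splits)
    qed
    then have "homogeneous (c n) F"
      unfolding homogeneous_def by blast
    moreover have "F \<subseteq> A \<inter> {..<n}"
      using F(1) Y(1) lt by auto
    ultimately show False
      using c F(2) by blast
  qed
qed

text \<open>Colour a pair by whether \<open>h\<close> agrees on it. The negative colour would make
  \<open>h\<close> injective on a set with more than \<open>Min A + 2\<close> elements, which
  exceeds the number of available values.\<close>

lemma large_pigeonhole:
  fixes h :: "nat \<Rightarrow> 'a"
  assumes "large (Suc k) A" and "h ` A \<subseteq> S" and "finite S" and "card S \<le> Min A + 2"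
  shows "\<exists>B\<subseteq>A. large k B \<and> (\<forall>x\<in>B. \<forall>y\<in>B. h x = h y)"
proof -
  obtain B where B: "B \<subseteq> A" "large k B" "homogeneous (\<lambda>x y. h x = h y) B"
    using assms(1) unfolding large.simps by blast
  then obtain e where e: "\<And>x y. x \<in> B \<Longrightarrow> y \<in> B \<Longrightarrow> x < y \<Longrightarrow> (h x = h y) = e"
    unfolding homogeneous_def by (elim exE) simp
  have "Min A \<le> Min B"
    using B large_0[OF B(2)] large_finite[OF assms(1)] by (auto intro: Min_antimono)
  then have "card (h ` B) < card B"
    using large_0[OF B(2)] assms B(1) card_mono[OF assms(3), of "h ` B"] by fastforce
  then have "\<not> inj_on h B"
    by (metis card_image nat_neq_iff)
  then obtain x y where "x \<in> B" "y \<in> B" "x < y" "h x = h y"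
    unfolding inj_on_def by (metis linorder_neqE)
  then have e
    using e[of x y] by simp
  then have "h x = h y" if "x \<in> B" "y \<in> B" for x y
    using e that by (metis linorder_neqE)
  then show ?thesis
    using B by blast
qed

text \<open>Pigeonhole applied to the map sending \<open>y\<close> to the set of all small
  \<open>x\<close> with \<open>c x y\<close>: the exponential bound leaves few enough such
  sets.\<close>

lemma large_uniform:
  fixes c :: "nat \<Rightarrow> nat \<Rightarrow> bool"
  assumes "large (Suc k) A"
  shows "\<exists>B\<subseteq>A. large k B \<and> (\<forall>x. 2 ^ Suc x \<le> Min A \<longrightarrow> (\<forall>y\<in>B. \<forall>z\<in>B. c x y = c x z))"
proof -
  define D where "D = {x :: nat. 2 ^ Suc x \<le> Min A}"
  have "D \<subseteq> {..<Min A}"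
  proof
    fix x assume "x \<in> D"
    moreover have "x < 2 ^ Suc x"
      by (metis Suc_lessD less_exp)
    ultimately show "x \<in> {..<Min A}"
      unfolding D_def by simp
  qed
  then have fin: "finite D"
    using finite_subset by blast
  \<comment> \<open>\<open>D\<close> has at most \<open>Max D + 1\<close> elements, and
    \<open>2 ^ Suc (Max D) \<le> Min A\<close> because \<open>Max D\<close> lies in
    \<open>D\<close>.\<close>
  have "2 ^ card D \<le> Min A + 2"
  proof (cases "D = {}")
    case False
    have "D \<subseteq> {..<Suc (Max D)}"
      using fin by (auto simp: less_Suc_eq_le)
    then have "card D \<le> Suc (Max D)"
      by (metis card_lessThan card_mono finite_lessThan)
    then have "(2::nat) ^ card D \<le> 2 ^ Suc (Max D)"
      by (intro power_increasing) auto
    moreover have "Max D \<in> D"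
      using False fin by simp
    ultimately show ?thesis
      unfolding D_def by simp
  qed simp
  then have "card (Pow D) \<le> Min A + 2"
    using fin by (simp add: card_Pow)
  moreover have "(\<lambda>y. {x \<in> D. c x y}) ` A \<subseteq> Pow D" "finite (Pow D)"
    using fin by auto
  ultimately
  obtain B where B: "B \<subseteq> A" "large k B" "\<And>y z. y \<in> B \<Longrightarrow> z \<in> B \<Longrightarrow> {x \<in> D. c x y} = {x \<in> D. c x z}"
    using large_pigeonhole[OF assms, of "\<lambda>y. {x \<in> D. c x y}"] by meson
  have "c x y = c x z" if "2 ^ Suc x \<le> Min A" "y \<in> B" "z \<in> B" for x y z
    using B(3)[OF that(2,3)] that(1) unfolding D_def by blast
  with B show ?thesis
    by blast
qed

lemma large_monochromatic:
  fixes d :: "nat \<Rightarrow> bool"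
  assumes "large (Suc k) A"
  shows "\<exists>B\<subseteq>A. large k B \<and> (\<exists>e. \<forall>x\<in>B. d x = e)"
proof -
  have "card (UNIV :: bool set) \<le> Min A + 2"
    by simp
  from large_pigeonhole[OF assms subset_UNIV finite this, of d]
  obtain B where B: "B \<subseteq> A" "large k B" "\<forall>x\<in>B. \<forall>y\<in>B. d x = d y"
    by (elim exE conjE)
  have "d x = d (Min B)" if "x \<in> B" for x
    using B that Min_in[OF large_finite[OF B(2)]] large_0[OF B(2)] by blast
  then have "\<forall>x\<in>B. d x = d (Min B)" ..
  with B(1,2) show ?thesis
    by (intro exI[of _ B] conjI exI[of _ "d (Min B)"])
qed

declare large.simps [simp del]

section \<open>Big sets\<close>

text \<open>The exponential gap places every point of an earlier block within the range covered by
  \<open>large_uniform\<close> for subsets of a later block.\<close>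

locale block_sequence =
  fixes U :: "nat filter" and I :: "nat \<Rightarrow> nat set"
  assumes selective: "selective U"
    and large_block: "\<And>n. large n (I n)"
    and block_growth: "\<And>m n x y. m < n \<Longrightarrow> x \<in> I m \<Longrightarrow> y \<in> I n \<Longrightarrow> 2 ^ Suc x \<le> y"
begin

lemma nonprincipal_ultrafilter: "nonprincipal_ultrafilter U"
  and ultrafilter: "ultrafilter U"
  and not_bot: "U \<noteq> bot"
  using selective by (auto simp: selective_def nonprincipal_ultrafilter_def ultrafilter_def)

lemmas eventually_ge = nonprincipal_ultrafilter_ge[OF nonprincipal_ultrafilter]

lemma block_less: "m < n \<Longrightarrow> x \<in> I m \<Longrightarrow> y \<in> I n \<Longrightarrow> x < y"
  using block_growth[of m n x y] less_exp[of "Suc x"] by linarith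

lemma block_unique: "x \<in> I m \<Longrightarrow> x \<in> I n \<Longrightarrow> m = n"
  using block_less by (metis less_irrefl linorder_neqE_nat)

definition big :: "nat set \<Rightarrow> bool" where
  "big X \<longleftrightarrow> (\<forall>k. \<forall>\<^sub>F n in U. large k (X \<inter> I n))"

definition almost_subset :: "nat set \<Rightarrow> nat set \<Rightarrow> bool"  (infix \<open>\<subseteq>*\<close> 50) where
  "X \<subseteq>* Y \<longleftrightarrow> (\<forall>\<^sub>F n in U. X \<inter> I n \<subseteq> Y)"

lemma almost_subset_refl: "X \<subseteq>* X"
  by (simp add: almost_subset_def)

lemma almost_subset_trans: "X \<subseteq>* Y \<Longrightarrow> Y \<subseteq>* Z \<Longrightarrow> X \<subseteq>* Z"
  unfolding almost_subset_def by (erule (1) eventually_elim2) blast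

lemma almost_subset_Int: "X \<subseteq>* Y \<Longrightarrow> X \<subseteq>* Z \<Longrightarrow> X \<subseteq>* Y \<inter> Z"
  unfolding almost_subset_def by (erule (1) eventually_elim2) blast

lemma subset_imp_almost: "X \<subseteq> Y \<Longrightarrow> X \<subseteq>* Y"
  unfolding almost_subset_def by (intro always_eventually) blast

lemma big_almost_superset:
  assumes "big X" and "X \<subseteq>* Y"
  shows "big Y"
  unfolding big_def
proof
  fix k
  have "\<forall>\<^sub>F n in U. large k (X \<inter> I n)"
    using assms(1) by (simp add: big_def)
  then show "\<forall>\<^sub>F n in U. large k (Y \<inter> I n)"
    using assms(2) unfolding almost_subset_def
  proof eventually_elim
    case (elim n)
    then show ?case
      using large_finite[OF large_block[of n]] by (intro large_superset[OF elim(1)]) auto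
  qed
qed

lemma big_UNIV: "big UNIV"
  unfolding big_def
proof
  fix k
  show "\<forall>\<^sub>F n in U. large k (UNIV \<inter> I n)"
    using eventually_ge[of k] by eventually_elim (simp add: large_mono[OF large_block])
qed

lemma big_unbounded: "big X \<Longrightarrow> \<exists>n>m. large k (X \<inter> I n)"
proof -
  assume "big X"
  then have "\<forall>\<^sub>F n in U. large k (X \<inter> I n)"
    by (simp add: big_def)
  then have "\<forall>\<^sub>F n in U. m < n \<and> large k (X \<inter> I n)"
    using eventually_ge[of "Suc m"] by eventually_elim simp
  then show ?thesis
    using eventually_happens not_bot by blast
qed

section \<open>Shrinking big sets block by block\<close>

lemma restrict_blocks:
  assumes "big X" and "\<forall>\<^sub>F n in U. n \<in> T"
  shows "big (X \<inter> (\<Union>n\<in>T. I n))"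
proof (rule big_almost_superset[OF assms(1)])
  show "X \<subseteq>* X \<inter> (\<Union>n\<in>T. I n)"
    unfolding almost_subset_def using assms(2) by eventually_elim blast
qed

text \<open>A property attainable at the cost of one unit of the norm can be imposed on all blocks
  at once: a norm tending to infinity along \<open>U\<close> still does so after losing one
  unit.\<close>

lemma shrink:
  assumes "big X"
    and step: "\<forall>n k A. A \<subseteq> I n \<longrightarrow> large (Suc k) A \<longrightarrow> (\<exists>B\<subseteq>A. large k B \<and> Q n B)"
  shows "\<exists>Y\<subseteq>X. big Y \<and> (\<forall>n. Y \<inter> I n \<noteq> {} \<longrightarrow> Q n (Y \<inter> I n))"
proof -
  \<comment> \<open>The step is applied at the greatest admissible \<open>k\<close>, which exists
    because of the cutoff \<open>k \<le> n\<close>; a block without admissible \<open>k\<close> is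
    emptied.\<close>
  have "\<exists>B\<subseteq>X \<inter> I n. (B \<noteq> {} \<longrightarrow> Q n B) \<and> (\<forall>k\<le>n. large (Suc k) (X \<inter> I n) \<longrightarrow> large k B)" for n
  proof (cases "\<exists>k\<le>n. large (Suc k) (X \<inter> I n)")
    case True
    then obtain k where k: "large (Suc k) (X \<inter> I n)"
      and le_k: "\<And>j. j \<le> n \<Longrightarrow> large (Suc j) (X \<inter> I n) \<Longrightarrow> j \<le> k"
      using Nat.ex_has_greatest_nat[of "\<lambda>k. k \<le> n \<and> large (Suc k) (X \<inter> I n)" _ n]
      by (simp del: large.simps) blast
    obtain B where "B \<subseteq> X \<inter> I n" "large k B" "Q n B"
      using step[rule_format, OF Int_lower2 k] by blast
    then show ?thesis
      using le_k large_mono by (intro exI[of _ B]) blast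
  next
    case False
    then show ?thesis
      by (intro exI[of _ "{}"]) simp
  qed
  then obtain B where B: "\<And>n. B n \<subseteq> X \<inter> I n" "\<And>n. B n \<noteq> {} \<Longrightarrow> Q n (B n)"
    "\<And>n k. k \<le> n \<Longrightarrow> large (Suc k) (X \<inter> I n) \<Longrightarrow> large k (B n)"
    by metis
  define Y where "Y = (\<Union>n. B n)"
  have Y_block: "Y \<inter> I n = B n" for n
    unfolding Y_def using B(1) block_unique by blast
  have "big Y"
    unfolding big_def
  proof
    fix k
    have "\<forall>\<^sub>F n in U. large (Suc k) (X \<inter> I n)"
      using assms(1) unfolding big_def by blast
    then show "\<forall>\<^sub>F n in U. large k (Y \<inter> I n)"
      using eventually_ge[of k] by eventually_elim (simp only: Y_block B(3))
  qed
  moreover have "Y \<subseteq> X"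
    unfolding Y_def using B(1) by blast
  ultimately show ?thesis
    using B(2) by (intro exI[of _ Y]) (simp add: Y_block)
qed

text \<open>The value \<open>e\<close> obtained by \<open>shrink\<close> may vary with the block;
  \<open>U\<close> selects one value, and the remaining blocks are discarded.\<close>

lemma shrink_uniform:
  fixes R :: "bool \<Rightarrow> nat set \<Rightarrow> bool"
  assumes "big X"
    and step: "\<forall>k A. large (Suc k) A \<longrightarrow> (\<exists>B\<subseteq>A. large k B \<and> (\<exists>e. R e B))"
  shows "\<exists>e Y. Y \<subseteq> X \<and> big Y \<and> (\<forall>n. Y \<inter> I n \<noteq> {} \<longrightarrow> R e (Y \<inter> I n))"
proof -
  obtain Y where Y: "Y \<subseteq> X" "big Y" "\<And>n. Y \<inter> I n \<noteq> {} \<Longrightarrow> \<exists>e. R e (Y \<inter> I n)"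
    using shrink[OF assms(1), of "\<lambda>n B. \<exists>e. R e B"] step by meson
  \<comment> \<open>Both values may work in a block, so \<open>U\<close> decides only whether
    \<open>R True\<close> holds; where it fails in a nonempty trace, \<open>R False\<close> must
    hold.\<close>
  obtain e where e: "\<forall>\<^sub>F n in U. R True (Y \<inter> I n) = e"
    using ultrafilter_decides[OF ultrafilter, of "\<lambda>n. R True (Y \<inter> I n)"] by blast
  define T where "T = {n. R True (Y \<inter> I n) = e}"
  let ?Z = "Y \<inter> (\<Union>n\<in>T. I n)"
  have "R e (?Z \<inter> I n)" if "?Z \<inter> I n \<noteq> {}" for n
  proof -
    have "n \<in> T"
      using that block_unique by blast
    then have "?Z \<inter> I n = Y \<inter> I n"
      by blast
    then show ?thesis
      using Y(3)[of n] that \<open>n \<in> T\<close> unfolding T_def by (cases e) (auto, metis (full_types))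
  qed
  moreover have "big ?Z"
    using e by (intro restrict_blocks Y) (simp add: T_def)
  ultimately show ?thesis
    using Y(1) by (intro exI[of _ e] exI[of _ ?Z]) blast
qed

definition block_homogeneous :: "(nat \<Rightarrow> nat \<Rightarrow> bool) \<Rightarrow> nat set \<Rightarrow> bool" where
  "block_homogeneous c X \<longleftrightarrow>
     (\<exists>e. \<forall>n. \<forall>x\<in>X \<inter> I n. \<forall>y\<in>X \<inter> I n. x < y \<longrightarrow> c x y = e) \<and>
     (\<exists>e. \<forall>m n. m < n \<longrightarrow> (\<forall>x\<in>X \<inter> I m. \<forall>y\<in>X \<inter> I n. c x y = e))"

lemma block_homogeneous_subset:
  "block_homogeneous c Y \<Longrightarrow> X \<subseteq> Y \<Longrightarrow> block_homogeneous c X"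
  unfolding block_homogeneous_def by (erule conj_forward; erule ex_forward) blast+

text \<open>\<open>X1\<close> fixes the colour inside blocks. For pairs across blocks,
  \<open>X2\<close> removes the dependence on the choice of \<open>y\<close> in its block,
  \<open>X3\<close> removes the dependence on that block, and \<open>X4\<close> removes the
  dependence on \<open>x\<close>.\<close>

lemma ex_block_homogeneous:
  assumes "big X"
  shows "\<exists>Y\<subseteq>X. big Y \<and> block_homogeneous c Y"
proof -
  have "\<forall>k A. large (Suc k) A \<longrightarrow>
      (\<exists>B\<subseteq>A. large k B \<and> (\<exists>e. \<forall>x\<in>B. \<forall>y\<in>B. x < y \<longrightarrow> c x y = e))"
    unfolding large.simps homogeneous_def[symmetric] by simp
  from shrink_uniform[OF assms, of "\<lambda>e B. \<forall>x\<in>B. \<forall>y\<in>B. x < y \<longrightarrow> c x y = e", OF this]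
  obtain e1 X1 where X1: "X1 \<subseteq> X" "big X1"
    "\<forall>n. X1 \<inter> I n \<noteq> {} \<longrightarrow> (\<forall>x\<in>X1 \<inter> I n. \<forall>y\<in>X1 \<inter> I n. x < y \<longrightarrow> c x y = e1)"
    by (elim exE conjE)
  \<comment> \<open>Make \<open>c x y\<close> depend only on \<open>x\<close> and on the block of \<open>y\<close>.\<close>
  have "\<forall>n k A. A \<subseteq> I n \<longrightarrow> large (Suc k) A \<longrightarrow>
      (\<exists>B\<subseteq>A. large k B \<and> (\<forall>m<n. \<forall>x\<in>I m. \<forall>y\<in>B. \<forall>z\<in>B. c x y = c x z))"
  proof (intro allI impI)
    fix n k A
    assume A: "A \<subseteq> I n" "large (Suc k) A"
    then have "Min A \<in> I n"
      using large_0 large_finite by (metis Min_in subsetD)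
    then have growth: "2 ^ Suc x \<le> Min A" if "m < n" "x \<in> I m" for m x
      using block_growth that by blast
    obtain B where B: "B \<subseteq> A" "large k B" "\<forall>x. 2 ^ Suc x \<le> Min A \<longrightarrow> (\<forall>y\<in>B. \<forall>z\<in>B. c x y = c x z)"
      using large_uniform[OF A(2), of c] by (elim exE conjE)
    then have "\<forall>m<n. \<forall>x\<in>I m. \<forall>y\<in>B. \<forall>z\<in>B. c x y = c x z"
      using growth by blast
    with B(1,2) show "\<exists>B\<subseteq>A. large k B \<and> (\<forall>m<n. \<forall>x\<in>I m. \<forall>y\<in>B. \<forall>z\<in>B. c x y = c x z)"
      by (intro exI[of _ B] conjI)
  qed
  from shrink[OF X1(2), of "\<lambda>n B. \<forall>m<n. \<forall>x\<in>I m. \<forall>y\<in>B. \<forall>z\<in>B. c x y = c x z", OF this]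
  obtain X2 where X2: "X2 \<subseteq> X1" "big X2" "\<forall>n. X2 \<inter> I n \<noteq> {} \<longrightarrow>
      (\<forall>m<n. \<forall>x\<in>I m. \<forall>y\<in>X2 \<inter> I n. \<forall>z\<in>X2 \<inter> I n. c x y = c x z)"
    by (elim exE conjE)
  define c' where "c' x n = (\<exists>y\<in>X2 \<inter> I n. c x y)" for x n
  have c': "c x y = c' x n" if "m < n" "x \<in> I m" "y \<in> X2 \<inter> I n" for m n x y
  proof
    assume "c' x n"
    then obtain z where "z \<in> X2 \<inter> I n" "c x z"
      unfolding c'_def by (elim bexE)
    then show "c x y"
      using X2(3) that by (metis empty_iff)
  next
    assume "c x y"
    then show "c' x n"
      unfolding c'_def using that(3) by (rule bexI)
  qed
  \<comment> \<open>\<open>d x\<close> is the limit along \<open>U\<close> of the colour between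
    \<open>x\<close> and later blocks. Since blocks are finite, the limit is attained simultaneously
    for all \<open>x\<close> in a block, and \<open>selective_diagonal\<close> applies to block
    indices.\<close>
  have "\<exists>d. \<forall>x. \<forall>\<^sub>F n in U. c' x n = d x"
    by (intro choice allI ultrafilter_decides ultrafilter)
  then obtain d where d: "\<And>x. \<forall>\<^sub>F n in U. c' x n = d x"
    by blast
  have "\<forall>\<^sub>F n in U. \<forall>x\<in>I m. c' x n = d x" for m
    using d large_finite[OF large_block] by (intro eventually_ball_finite) auto
  from selective_diagonal[of U "\<lambda>m n. \<forall>x\<in>I m. c' x n = d x", OF selective this]
  obtain T where T: "\<forall>\<^sub>F n in U. n \<in> T"
    "\<forall>m\<in>T. \<forall>n\<in>T. m < n \<longrightarrow> (\<forall>x\<in>I m. c' x n = d x)"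
    by (elim exE conjE)
  define X3 where "X3 = X2 \<inter> (\<Union>n\<in>T. I n)"
  have "big X3"
    unfolding X3_def by (rule restrict_blocks[OF X2(2) T(1)])
  moreover have "\<forall>k A. large (Suc k) A \<longrightarrow> (\<exists>B\<subseteq>A. large k B \<and> (\<exists>e. \<forall>x\<in>B. d x = e))"
    using large_monochromatic by simp
  ultimately have "\<exists>e Y. Y \<subseteq> X3 \<and> big Y \<and> (\<forall>n. Y \<inter> I n \<noteq> {} \<longrightarrow> (\<forall>x\<in>Y \<inter> I n. d x = e))"
    by (rule shrink_uniform)
  then
  obtain e4 X4 where X4: "X4 \<subseteq> X3" "big X4" "\<forall>n. X4 \<inter> I n \<noteq> {} \<longrightarrow> (\<forall>x\<in>X4 \<inter> I n. d x = e4)"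
    by (elim exE conjE)
  have "c x y = e4" if "m < n" "x \<in> X4 \<inter> I m" "y \<in> X4 \<inter> I n" for m n x y
  proof -
    have "m \<in> T" "n \<in> T" "y \<in> X2 \<inter> I n"
      using that X4(1) block_unique unfolding X3_def by blast+
    then have "c x y = c' x n" "c' x n = d x" "d x = e4"
      using c'[of m n x y] T(2) X4(3) that by auto
    then show ?thesis
      by simp
  qed
  then have "\<forall>m n. m < n \<longrightarrow> (\<forall>x\<in>X4 \<inter> I m. \<forall>y\<in>X4 \<inter> I n. c x y = e4)"
    by (intro allI ballI impI)
  moreover have "c x y = e1" if "x \<in> X4 \<inter> I n" "y \<in> X4 \<inter> I n" "x < y" for n x y
  proof -
    have "x \<in> X1 \<inter> I n" "y \<in> X1 \<inter> I n"
      using that X4(1) X2(1) unfolding X3_def by blast+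
    then show ?thesis
      using X1(3) that(3) by auto
  qed
  then have "\<forall>n. \<forall>x\<in>X4 \<inter> I n. \<forall>y\<in>X4 \<inter> I n. x < y \<longrightarrow> c x y = e1"
    by (intro allI ballI impI)
  ultimately have "block_homogeneous c X4"
    unfolding block_homogeneous_def by (intro conjI exI)
  moreover have "X4 \<subseteq> X"
    using X4(1) X2(1) X1(1) unfolding X3_def by blast
  ultimately show ?thesis
    using X4(2) by blast
qed

text \<open>Diagonalisation: in block \<open>n\<close> take the trace of the \<open>i n\<close>-th
  finite intersection, with \<open>i n\<close> as large as the norm allows. Both the norm and
  \<open>i n\<close> then tend to infinity along \<open>U\<close>.\<close>

lemma countable_lower_bound:
  assumes "countable \<F>" and big: "\<And>X. X \<in> \<F> \<Longrightarrow> big X"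
    and chain: "\<And>X Y. X \<in> \<F> \<Longrightarrow> Y \<in> \<F> \<Longrightarrow> X \<subseteq>* Y \<or> Y \<subseteq>* X"
  shows "\<exists>Z. big Z \<and> (\<forall>X\<in>\<F>. Z \<subseteq>* X)"
proof (cases "\<F> = {}")
  case True
  then show ?thesis
    using big_UNIV by blast
next
  case False
  define A where "A = from_nat_into \<F>"
  have A: "A i \<in> \<F>" for i
    unfolding A_def by (rule from_nat_into[OF False])
  have range_A: "\<exists>i. X = A i" if "X \<in> \<F>" for X
    unfolding A_def using from_nat_into_surj[OF assms(1) that] by metis
  define Y where "Y i = (\<Inter>j\<le>i. A j)" for i
  \<comment> \<open>In a chain, a finite intersection almost contains one of its members and is
    therefore big.\<close>
  have "\<exists>j. A j \<subseteq>* Y i" for i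
  proof (induction i)
    case 0
    show ?case
      using almost_subset_refl[of "A 0"] by (intro exI[of _ 0]) (simp add: Y_def)
  next
    case (Suc i)
    then obtain j where j: "A j \<subseteq>* Y i"
      by blast
    have Y_Suc: "Y (Suc i) = Y i \<inter> A (Suc i)"
      by (auto simp: Y_def atMost_Suc)
    from chain[OF A A, of j "Suc i"] show ?case
      unfolding Y_Suc using j almost_subset_Int almost_subset_trans almost_subset_refl by metis
  qed
  then have "big (Y i)" for i
    using big A big_almost_superset by metis
  then have large_Y: "\<forall>\<^sub>F n in U. k \<le> n \<and> large k (Y k \<inter> I n)" for k
    unfolding big_def using eventually_ge[of k] by (simp add: eventually_conj_iff)
  \<comment> \<open>The greatest \<open>k \<le> n\<close> whose intersection is
    \<open>k\<close>-large in block \<open>n\<close> serves as \<open>i\<close>; if there is none,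
    any value will do.\<close>
  have "\<exists>i. \<forall>k. k \<le> n \<and> large k (Y k \<inter> I n) \<longrightarrow> large i (Y i \<inter> I n) \<and> k \<le> i" for n
  proof (cases "\<exists>k. k \<le> n \<and> large k (Y k \<inter> I n)")
    case True
    then obtain k where "k \<le> n \<and> large k (Y k \<inter> I n)"
      by (elim exE)
    from Nat.ex_has_greatest_nat[of "\<lambda>k. k \<le> n \<and> large k (Y k \<inter> I n)", OF this, of n]
    show ?thesis
      by blast
  qed blast
  then obtain i where i: "\<And>n k. k \<le> n \<and> large k (Y k \<inter> I n) \<Longrightarrow> large (i n) (Y (i n) \<inter> I n) \<and> k \<le> i n"
    by metis
  define Z where "Z = (\<Union>n. Y (i n) \<inter> I n)"
  have Z_block: "Z \<inter> I n = Y (i n) \<inter> I n" for n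
    unfolding Z_def using block_unique by blast
  have "big Z"
    unfolding big_def
  proof
    fix k
    show "\<forall>\<^sub>F n in U. large k (Z \<inter> I n)"
      using large_Y[of k] by eventually_elim (use i large_mono Z_block in metis)
  qed
  moreover have "Z \<subseteq>* A k" for k
    unfolding almost_subset_def Z_block using large_Y[of k]
  proof eventually_elim
    case (elim n)
    then have "k \<le> i n"
      using i by blast
    then show ?case
      unfolding Y_def by auto
  qed
  ultimately show ?thesis
    using range_A by metis
qed

end

section \<open>The ultrafilter\<close>

text \<open>In the cardinal well-order of \<open>nat set\<close>, a proper initial segment has
  cardinality below \<open>cardSuc natLeq\<close>, so it is countable.\<close>

lemma Continuum_Hypothesis_well_order:
  assumes Continuum_Hypothesis
  shows "\<exists>R :: nat set rel. wf R \<and> (\<forall>a b. a = b \<or> (a, b) \<in> R \<or> (b, a) \<in> R) \<and>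
           (\<forall>a. countable {b. (b, a) \<in> R})"
proof -
  define r where "r = |UNIV :: nat set set|"
  have CH: "r =o cardSuc natLeq"
    using assms by (simp add: Continuum_Hypothesis_def r_def)
  have card: "Card_order r"
    unfolding r_def by (rule card_of_Card_order)
  have field: "Field r = UNIV"
    unfolding r_def by (rule Field_card_of)
  have wo: "well_order_on UNIV r"
    unfolding r_def by (rule card_of_well_order_on)
  have "countable {b. (b, a) \<in> r - Id}" for a
  proof -
    have "{b. (b, a) \<in> r - Id} = underS r a"
      by (auto simp: underS_def)
    moreover have "|underS r a| <o cardSuc natLeq"
      using card_of_underS[OF card] CH field by (metis UNIV_I ordLess_ordIso_trans)
    then have "|underS r a| \<le>o natLeq"
      by (rule cardSuc_ordLeq_ordLess[OF natLeq_Card_order card_of_Card_order, THEN iffD1])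
    ultimately show ?thesis
      by (simp add: countable_card_le_natLeq)
  qed
  moreover have "wf (r - Id)"
    using wo by (simp add: well_order_on_def)
  moreover have "a = b \<or> (a, b) \<in> r - Id \<or> (b, a) \<in> r - Id" for a b
    using wo unfolding well_order_on_def linear_order_on_def total_on_def by blast
  ultimately show ?thesis
    by (intro exI[of _ "r - Id"]) blast
qed

text \<open>Transfinite recursion over codes of colourings: the countably many earlier sets have a
  big lower bound, which is then made block homogeneous for the current colouring.\<close>

lemma (in block_sequence) ex_tower:
  assumes Continuum_Hypothesis
  shows "\<exists>G. (\<forall>c. big (G c) \<and> block_homogeneous c (G c)) \<and> (\<forall>c d. G c \<subseteq>* G d \<or> G d \<subseteq>* G c)"
proof -
  obtain R :: "nat set rel" where R: "wf R" "\<And>a b. a = b \<or> (a, b) \<in> R \<or> (b, a) \<in> R"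
    "\<And>a. countable {b. (b, a) \<in> R}"
    using Continuum_Hypothesis_well_order[OF assms] by blast
  \<comment> \<open>Sets of numbers code colourings through the pairing function, so that the
    well-order of \<open>nat set\<close> enumerates all of them.\<close>
  define decode where "decode a x y \<longleftrightarrow> prod_encode (x, y) \<in> a" for a :: "nat set" and x y
  define P where "P f a X \<longleftrightarrow> big X \<and> block_homogeneous (decode a) X \<and>
      (\<forall>b. (b, a) \<in> R \<longrightarrow> X \<subseteq>* f b)" for f :: "nat set \<Rightarrow> nat set" and a X
  have "\<exists>f. \<forall>a. P f a (f a)"
    using R(1)
  proof (rule dependent_wf_choice)
    show "P f a X = P g a X" if "\<And>b. (b, a) \<in> R \<Longrightarrow> f b = g b" for f g a X
      using that by (simp add: P_def)
    show "\<exists>X. P f a X" if *: "\<And>b. (b, a) \<in> R \<Longrightarrow> P f b (f b)" for a f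
    proof -
      let ?F = "f ` {b. (b, a) \<in> R}"
      have countable: "countable ?F"
        using R(3) by simp
      have big: "big X" if "X \<in> ?F" for X
        using that * by (auto simp: P_def)
      have chain: "X \<subseteq>* Y \<or> Y \<subseteq>* X" if XY: "X \<in> ?F" "Y \<in> ?F" for X Y
      proof -
        obtain b b' where b: "X = f b" "(b, a) \<in> R" and b': "Y = f b'" "(b', a) \<in> R"
          using XY by blast
        then show ?thesis
          using R(2)[of b b'] *[OF b(2)] *[OF b'(2)] almost_subset_refl unfolding P_def by blast
      qed
      have "\<exists>Z. big Z \<and> (\<forall>X\<in>?F. Z \<subseteq>* X)"
        by (rule countable_lower_bound[OF countable]) (fact big, fact chain)
      then obtain Z where Z: "big Z" "\<forall>X\<in>?F. Z \<subseteq>* X"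
        by (elim exE conjE)
      obtain Y where Y: "Y \<subseteq> Z" "big Y" "block_homogeneous (decode a) Y"
        using ex_block_homogeneous[OF Z(1)] by blast
      have "Y \<subseteq>* f b" if "(b, a) \<in> R" for b
        using almost_subset_trans[OF subset_imp_almost[OF Y(1)]] Z(2) that by blast
      then show ?thesis
        using Y(2,3) unfolding P_def by blast
    qed
  qed
  then obtain f where f: "\<And>a. P f a (f a)"
    by blast
  define G where "G c = f {prod_encode (x, y) | x y. c x y}" for c
  have decode: "decode {prod_encode (x, y) | x y. c x y} = c" for c
    by (intro ext) (auto simp: decode_def)
  have "big (G c)" "block_homogeneous c (G c)" for c
    using f[of "{prod_encode (x, y) | x y. c x y}"] unfolding P_def G_def decode by simp_all
  moreover have "f a \<subseteq>* f b \<or> f b \<subseteq>* f a" for a b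
    using R(2)[of a b] f[of a] f[of b] almost_subset_refl unfolding P_def by blast
  then have "G c \<subseteq>* G d \<or> G d \<subseteq>* G c" for c d
    by (simp add: G_def)
  ultimately show ?thesis
    by (intro exI[of _ G]) simp
qed

section \<open>The filter generated by a tower\<close>

locale tower = block_sequence +
  fixes G :: "(nat \<Rightarrow> nat \<Rightarrow> bool) \<Rightarrow> nat set"
  assumes big_tower: "\<And>c. big (G c)"
    and block_homogeneous_tower: "\<And>c. block_homogeneous c (G c)"
    and tower_chain: "\<And>c d. almost_subset (G c) (G d) \<or> almost_subset (G d) (G c)"
begin

text \<open>This is the filter generated by the sets
  \<open>G c \<inter> (\<Union>n\<in>T. I n)\<close> with \<open>T\<close> in
  \<open>U\<close>.\<close>

definition V :: "nat filter" where
  "V = Abs_filter (\<lambda>P. \<exists>c. \<forall>\<^sub>F n in U. \<forall>x\<in>G c \<inter> I n. P x)"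

lemma eventually_V: "eventually P V \<longleftrightarrow> (\<exists>c. \<forall>\<^sub>F n in U. \<forall>x\<in>G c \<inter> I n. P x)"
  unfolding V_def
proof (rule eventually_Abs_filter, rule is_filter.intro)
  show "\<exists>c. \<forall>\<^sub>F n in U. \<forall>x\<in>G c \<inter> I n. True"
    by simp
next
  fix P Q
  assume "\<exists>c. \<forall>\<^sub>F n in U. \<forall>x\<in>G c \<inter> I n. P x" "\<exists>c. \<forall>\<^sub>F n in U. \<forall>x\<in>G c \<inter> I n. Q x"
  then obtain c d where c: "\<forall>\<^sub>F n in U. \<forall>x\<in>G c \<inter> I n. P x" and d: "\<forall>\<^sub>F n in U. \<forall>x\<in>G d \<inter> I n. Q x"
    by blast
  \<comment> \<open>Closure under intersection comes from the chain condition: the almost smaller of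
    the two tower sets witnesses both properties.\<close>
  obtain b where "G b \<subseteq>* G c" "G b \<subseteq>* G d"
    using tower_chain[of c d] almost_subset_refl by blast
  then have "\<forall>\<^sub>F n in U. \<forall>x\<in>G b \<inter> I n. P x \<and> Q x"
    using c d unfolding almost_subset_def by eventually_elim blast
  then show "\<exists>c. \<forall>\<^sub>F n in U. \<forall>x\<in>G c \<inter> I n. P x \<and> Q x"
    by blast
next
  fix P Q :: "nat \<Rightarrow> bool"
  assume imp: "\<forall>x. P x \<longrightarrow> Q x" and "\<exists>c. \<forall>\<^sub>F n in U. \<forall>x\<in>G c \<inter> I n. P x"
  then obtain c where "\<forall>\<^sub>F n in U. \<forall>x\<in>G c \<inter> I n. P x"
    by blast
  then have "\<forall>\<^sub>F n in U. \<forall>x\<in>G c \<inter> I n. Q x"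
    by eventually_elim (use imp in blast)
  then show "\<exists>c. \<forall>\<^sub>F n in U. \<forall>x\<in>G c \<inter> I n. Q x"
    by blast
qed

lemma eventually_tower: "\<forall>\<^sub>F x in V. x \<in> G c \<inter> (\<Union>n. I n)"
  unfolding eventually_V by (intro exI[of _ c] always_eventually) blast

lemma eventually_blocks:
  assumes "\<forall>\<^sub>F n in U. P n"
  shows "\<forall>\<^sub>F x in V. \<exists>n. x \<in> I n \<and> P n"
proof -
  have "\<forall>\<^sub>F n in U. \<forall>x\<in>G c \<inter> I n. \<exists>n. x \<in> I n \<and> P n" for c
    using assms by eventually_elim blast
  then show ?thesis
    unfolding eventually_V by blast
qed

lemma eventually_V_imp_big:
  assumes "\<forall>\<^sub>F x in V. x \<in> X"
  shows "big X"
proof -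
  obtain c where "\<forall>\<^sub>F n in U. \<forall>x\<in>G c \<inter> I n. x \<in> X"
    using assms unfolding eventually_V by blast
  then have "G c \<subseteq>* X"
    unfolding almost_subset_def by eventually_elim blast
  then show ?thesis
    using big_almost_superset big_tower by blast
qed

text \<open>The form in which bigness is used below: every set in \<open>V\<close> has relatively
  large traces arbitrarily far out.\<close>

lemma eventually_V_imp_large:
  assumes "\<forall>\<^sub>F x in V. x \<in> X"
  obtains n where "m < n" "large 0 (X \<inter> I n)"
  using big_unbounded[OF eventually_V_imp_big[OF assms], of m 0] by blast

lemma V_homogeneous:
  fixes c :: "nat \<Rightarrow> nat \<Rightarrow> bool"
  shows "\<exists>X e e'. (\<forall>\<^sub>F x in V. x \<in> X) \<and> X \<subseteq> (\<Union>n. I n) \<and>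
     (\<forall>n. \<forall>x\<in>X \<inter> I n. \<forall>y\<in>X \<inter> I n. x < y \<longrightarrow> c x y = e) \<and>
     (\<forall>m n. m < n \<longrightarrow> (\<forall>x\<in>X \<inter> I m. \<forall>y\<in>X \<inter> I n. c x y = e'))"
proof -
  have "block_homogeneous c (G c \<inter> (\<Union>n. I n))"
    using block_homogeneous_subset[OF block_homogeneous_tower] by blast
  then obtain e e' where
    "\<forall>n. \<forall>x\<in>G c \<inter> (\<Union>n. I n) \<inter> I n. \<forall>y\<in>G c \<inter> (\<Union>n. I n) \<inter> I n. x < y \<longrightarrow> c x y = e"
    "\<forall>m n. m < n \<longrightarrow> (\<forall>x\<in>G c \<inter> (\<Union>n. I n) \<inter> I m. \<forall>y\<in>G c \<inter> (\<Union>n. I n) \<inter> I n. c x y = e')"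
    unfolding block_homogeneous_def by (elim exE conjE)
  then show ?thesis
    by (intro exI conjI) (rule eventually_tower Int_lower2 | assumption)+
qed

text \<open>To decide \<open>C\<close>, colour \<open>x < y\<close> by \<open>x \<in> C\<close>:
  every point of the homogeneous set has a partner in a later block, so the cross-block colour
  settles its membership. A singleton is too small to have a relatively large trace.\<close>

lemma nonprincipal_ultrafilter_V: "nonprincipal_ultrafilter V"
proof -
  have "V \<noteq> bot"
  proof
    assume "V = bot"
    then have "\<forall>\<^sub>F x in V. x \<in> {}"
      by simp
    then show False
      by (rule eventually_V_imp_large[where m = 0]) (use large_0 in blast)
  qed
  moreover have "(\<forall>\<^sub>F x in V. x \<in> C) \<or> (\<forall>\<^sub>F x in V. x \<notin> C)" for C
  proof -
    obtain X e' where X: "\<forall>\<^sub>F x in V. x \<in> X" "X \<subseteq> (\<Union>n. I n)"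
      "\<forall>m n. m < n \<longrightarrow> (\<forall>x\<in>X \<inter> I m. \<forall>y\<in>X \<inter> I n. (x \<in> C) = e')"
      using V_homogeneous[of "\<lambda>x y. x \<in> C"] by (elim exE conjE)
    have "(x \<in> C) = e'" if x: "x \<in> X" for x
    proof -
      obtain m where m: "x \<in> I m"
        using X(2) x by blast
      obtain n where "m < n" "large 0 (X \<inter> I n)"
        by (rule eventually_V_imp_large[OF X(1)])
      moreover from this obtain y where "y \<in> X \<inter> I n"
        using large_0 by blast
      ultimately show ?thesis
        using X(3)[rule_format, of m n x y] m x by simp
    qed
    then have "\<forall>\<^sub>F x in V. (x \<in> C) = e'"
      using X(1) by (auto elim: eventually_mono)
    then show ?thesis
      by (cases e') simp_all
  qed
  moreover have "V \<noteq> principal {x}" for x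
  proof
    assume "V = principal {x}"
    then have "\<forall>\<^sub>F y in V. y \<in> {x}"
      by (simp add: eventually_principal)
    then obtain n where "large 0 ({x} \<inter> I n)"
      by (rule eventually_V_imp_large)
    moreover have "card ({x} \<inter> I n) \<le> 1"
      using card_mono[of "{x}" "{x} \<inter> I n"] by simp
    ultimately show False
      using large_0[of 0 "{x} \<inter> I n"] by simp
  qed
  ultimately show ?thesis
    by (simp add: nonprincipal_ultrafilter_def ultrafilter_def)
qed

section \<open>Projection to \<open>U\<close>, and the properties of \<open>V\<close>\<close>

text \<open>The value outside the blocks is unspecified, which is harmless because \<open>V\<close>
  concentrates on their union.\<close>

definition block_index :: "nat \<Rightarrow> nat" where
  "block_index x = (THE n. x \<in> I n)"

lemma block_index: "x \<in> I n \<Longrightarrow> block_index x = n"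
  unfolding block_index_def using block_unique by blast

text \<open>Sets in \<open>U\<close> pull back to sets in \<open>V\<close>. Equality follows because
  \<open>U\<close> is an ultrafilter and \<open>V\<close> is proper.\<close>

lemma rudin_keisler_above_V: "rudin_keisler_above V U"
proof -
  have V_not_bot: "V \<noteq> bot"
    using nonprincipal_ultrafilter_V by (simp add: nonprincipal_ultrafilter_def ultrafilter_def)
  have forward: "\<forall>\<^sub>F x in V. P (block_index x)" if "\<forall>\<^sub>F n in U. P n" for P
    using eventually_blocks[OF that] by eventually_elim (use block_index in blast)
  have "\<forall>\<^sub>F n in U. P n" if "\<forall>\<^sub>F x in V. P (block_index x)" for P
  proof (rule ccontr)
    assume "\<not> ?thesis"
    then have "\<forall>\<^sub>F n in U. \<not> P n"
      using ultrafilter_cases[OF ultrafilter] by blast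
    then have "\<forall>\<^sub>F x in V. False"
      by (rule eventually_elim2[OF forward that]) simp
    then show False
      using V_not_bot by simp
  qed
  then have "U = filtermap block_index V"
    using forward by (intro filter_eqI) (auto simp: eventually_filtermap)
  then show ?thesis
    unfolding rudin_keisler_above_def by blast
qed

text \<open>The distance to the top of the block strictly decreases inside each block, while every
  set in \<open>V\<close> has two points in a common block.\<close>

lemma not_selective_V: "\<not> selective V"
proof
  assume "selective V"
  then obtain g :: "nat \<Rightarrow> nat" where
    g: "mono g" "\<forall>\<^sub>F x in V. Max (I (block_index x)) - x = g x"
    unfolding selective_def by (elim conjE allE[of _ "\<lambda>x. Max (I (block_index x)) - x"] exE)
  define X where "X = {x. Max (I (block_index x)) - x = g x}"
  have "\<forall>\<^sub>F x in V. x \<in> X"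
    using g(2) by (simp add: X_def)
  then obtain n where n: "large 0 (X \<inter> I n)"
    by (rule eventually_V_imp_large)
  obtain x y where xy: "x \<in> X \<inter> I n" "y \<in> X \<inter> I n" "x < y"
  proof -
    have "\<not> is_singleton (X \<inter> I n)" "X \<inter> I n \<noteq> {}"
      using large_0[OF n] by (auto simp: is_singleton_altdef)
    then obtain a b where "a \<in> X \<inter> I n" "b \<in> X \<inter> I n" "a \<noteq> b"
      by (metis is_singletonI')
    then show ?thesis
      using that by (metis linorder_neqE_nat)
  qed
  then have "Max (I n) - x = g x" "Max (I n) - y = g y"
    using block_index by (auto simp: X_def)
  moreover have "y \<le> Max (I n)"
    using xy large_finite[OF large_block] by simp
  moreover have "g x \<le> g y"
    using g(1) xy(3) by (simp add: monoD)
  ultimately show False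
    using xy(3) by linarith
qed

lemma quasi_selective_V: "quasi_selective V"
  unfolding quasi_selective_def
proof (intro conjI nonprincipal_ultrafilter_V allI impI)
  fix f :: "nat \<Rightarrow> nat"
  assume regressive: "\<forall>n. f n \<le> n"
  obtain X e e' where X: "\<forall>\<^sub>F x in V. x \<in> X" "X \<subseteq> (\<Union>n. I n)"
    "\<forall>n. \<forall>x\<in>X \<inter> I n. \<forall>y\<in>X \<inter> I n. x < y \<longrightarrow> (f x \<le> f y) = e"
    "\<forall>m n. m < n \<longrightarrow> (\<forall>x\<in>X \<inter> I m. \<forall>y\<in>X \<inter> I n. (f x \<le> f y) = e')"
    using V_homogeneous[of "\<lambda>x y. f x \<le> f y"] by (elim exE conjE)
  \<comment> \<open>Otherwise \<open>f\<close> is strictly decreasing on a relatively large trace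
    \<open>A\<close>. It is then injective with values at most \<open>f (Min A) \<le> Min A\<close>,
    which leaves room for only \<open>Min A + 1\<close> points.\<close>
  have e
  proof (rule ccontr)
    assume "\<not> e"
    then have decr: "f y < f x" if "x \<in> X \<inter> I n" "y \<in> X \<inter> I n" "x < y" for n x y
      using X(3)[rule_format, OF that] by simp
    obtain n where n: "large 0 (X \<inter> I n)"
      by (rule eventually_V_imp_large[OF X(1)])
    define A where "A = X \<inter> I n"
    have A: "finite A" "A \<noteq> {}" "Min A + 2 < card A"
      using large_0[OF n] large_finite[OF n] by (simp_all add: A_def)
    have "inj_on f A"
      using decr[of _ n] unfolding A_def inj_on_def by (metis less_irrefl linorder_neqE_nat)
    moreover have "f ` A \<subseteq> {..Min A}"
    proof
      fix z assume "z \<in> f ` A"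
      then obtain y where y: "y \<in> A" "z = f y"
        by blast
      have "Min A \<le> y" "Min A \<in> A"
        using A y by simp_all
      then have "f y \<le> f (Min A)"
        using decr[of "Min A" n y] y(1) unfolding A_def by (cases "Min (X \<inter> I n) = y") auto
      then show "z \<in> {..Min A}"
        using regressive y(2) by (auto intro: order_trans)
    qed
    ultimately have "card A \<le> Suc (Min A)"
      by (metis card_atMost card_inj_on_le finite_atMost)
    then show False
      using A(3) by simp
  qed
  \<comment> \<open>A point of \<open>X\<close> where \<open>f\<close> is minimal, paired with a
    point of a later block, rules out the negative colour.\<close>
  have e'
  proof (rule ccontr)
    assume "\<not> e'"
    obtain n0 where "large 0 (X \<inter> I n0)"
      by (rule eventually_V_imp_large[OF X(1)])
    then have "\<exists>x. x \<in> X"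
      using large_0 by blast
    then obtain x where x: "x \<in> X" "\<And>y. y \<in> X \<Longrightarrow> f x \<le> f y"
      using ex_has_least_nat[of "\<lambda>x. x \<in> X" _ f] by blast
    obtain m where m: "x \<in> I m"
      using X(2) x(1) by blast
    obtain n where n: "m < n" "large 0 (X \<inter> I n)"
      by (rule eventually_V_imp_large[OF X(1)])
    then obtain y where "y \<in> X \<inter> I n"
      using large_0 by blast
    then show False
      using X(4)[rule_format, OF n(1), of x y] x m \<open>\<not> e'\<close> by simp
  qed
  have mono_f: "f x \<le> f y" if xy: "x \<in> X" "y \<in> X" "x \<le> y" for x y
  proof -
    obtain m n where mn: "x \<in> I m" "y \<in> I n"
      using X(2) xy by blast
    consider "x = y" | "m = n" "x < y" | "m < n"
      using block_less[of n m y x] mn xy(3) by fastforce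
    then show ?thesis
      using X(3)[rule_format, of x m y] X(4)[rule_format, of m n x y] mn xy \<open>e\<close> \<open>e'\<close> by cases auto
  qed
  \<comment> \<open>The running maximum of \<open>f\<close> over \<open>X\<close> extends
    \<open>f\<close> monotonically from \<open>X\<close>; the inserted 0 covers arguments below all
    of \<open>X\<close>.\<close>
  define g where "g n = Max (insert 0 (f ` {x \<in> X. x \<le> n}))" for n
  have "mono g"
    unfolding g_def by (intro monoI Max_mono) auto
  moreover have "f n = g n" if "n \<in> X" for n
    unfolding g_def using that mono_f by (intro Max_eqI[symmetric]) auto
  then have "\<forall>\<^sub>F n in V. f n = g n"
    using X(1) by (auto elim: eventually_mono)
  ultimately show "\<exists>g. mono g \<and> (\<forall>\<^sub>F n in V. f n = g n)"
    by blast
qed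

text \<open>Homogenising for membership in \<open>P 0\<close> and in \<open>P 1\<close> determines
  the piece of a pair, once for pairs inside a block and once for pairs across blocks.\<close>

lemma partition_relation_V: "partition_relation_2_3 V"
  unfolding partition_relation_2_3_def
proof (intro allI impI)
  fix P :: "nat \<Rightarrow> nat set set"
  assume P: "disjoint_family_on P {..<3} \<and> (\<Union>i<3. P i) = [UNIV]\<^bsup>2\<^esup>"
  obtain X0 e0 e0' where X0: "\<forall>\<^sub>F x in V. x \<in> X0" "X0 \<subseteq> (\<Union>n. I n)"
    "\<forall>n. \<forall>x\<in>X0 \<inter> I n. \<forall>y\<in>X0 \<inter> I n. x < y \<longrightarrow> ({x, y} \<in> P 0) = e0"
    "\<forall>m n. m < n \<longrightarrow> (\<forall>x\<in>X0 \<inter> I m. \<forall>y\<in>X0 \<inter> I n. ({x, y} \<in> P 0) = e0')"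
    using V_homogeneous[of "\<lambda>x y. {x, y} \<in> P 0"] by (elim exE conjE)
  obtain X1 e1 e1' where X1: "\<forall>\<^sub>F x in V. x \<in> X1" "X1 \<subseteq> (\<Union>n. I n)"
    "\<forall>n. \<forall>x\<in>X1 \<inter> I n. \<forall>y\<in>X1 \<inter> I n. x < y \<longrightarrow> ({x, y} \<in> P 1) = e1"
    "\<forall>m n. m < n \<longrightarrow> (\<forall>x\<in>X1 \<inter> I m. \<forall>y\<in>X1 \<inter> I n. ({x, y} \<in> P 1) = e1')"
    using V_homogeneous[of "\<lambda>x y. {x, y} \<in> P 1"] by (elim exE conjE)
  \<comment> \<open>Recovers the index of a piece from two membership tests; by elimination, failing
    both means piece 2.\<close>
  define colour where "colour a b = (if a then 0 else if b then 1 else 2 :: nat)" for a b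
  have colour: "i = colour (X \<in> P 0) (X \<in> P 1)" if X: "i < 3" "X \<in> P i" for i X
  proof -
    have "X \<notin> P j" if "j < 3" "j \<noteq> i" for j
    proof -
      have "P i \<inter> P j = {}"
        using P X(1) that by (intro disjoint_family_onD[of P "{..<3}"]) auto
      then show ?thesis
        using X(2) by blast
    qed
    from this[of 0] this[of 1] have "X \<in> P 0 \<longrightarrow> i = 0" "X \<in> P 1 \<longrightarrow> i = 1"
      by auto
    moreover have "i = 0 \<or> i = 1 \<or> i = 2"
      using X(1) by linarith
    ultimately show ?thesis
      using X(2) unfolding colour_def by auto
  qed
  have "i \<in> {colour e0 e1, colour e0' e1'}" if i: "i < 3" "[X0 \<inter> X1]\<^bsup>2\<^esup> \<inter> P i \<noteq> {}" for i
  proof -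
    obtain a b where ab: "a \<in> X0 \<inter> X1" "b \<in> X0 \<inter> X1" "a \<noteq> b" "{a, b} \<in> P i"
      using i(2) by (auto elim!: nsets2_E)
    obtain x y where xy: "x \<in> X0 \<inter> X1" "y \<in> X0 \<inter> X1" "x < y" "{x, y} \<in> P i"
      using ab by (metis insert_commute linorder_neqE_nat)
    obtain m n where mn: "x \<in> I m" "y \<in> I n"
      using X0(2) xy by blast
    consider "m = n" | "m < n"
      using block_less[of n m y x] mn xy(3) by fastforce
    then show ?thesis
    proof cases
      case 1
      then show ?thesis
        using colour[OF i(1) xy(4)] X0(3)[rule_format, of x n y] X1(3)[rule_format, of x n y] mn xy by simp
    next
      case 2
      then show ?thesis
        using colour[OF i(1) xy(4)] X0(4)[rule_format, of m n x y] X1(4)[rule_format, of m n x y] mn xy by simp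
    qed
  qed
  then have "{i. i < 3 \<and> [X0 \<inter> X1]\<^bsup>2\<^esup> \<inter> P i \<noteq> {}} \<subseteq> {colour e0 e1, colour e0' e1'}"
    by blast
  then have "card {i. i < 3 \<and> [X0 \<inter> X1]\<^bsup>2\<^esup> \<inter> P i \<noteq> {}} \<le> card {colour e0 e1, colour e0' e1'}"
    by (intro card_mono) auto
  also have "\<dots> \<le> 2"
    by (simp add: card_insert_if)
  finally show "\<exists>H. (\<forall>\<^sub>F n in V. n \<in> H) \<and> card {i. i < 3 \<and> [H]\<^bsup>2\<^esup> \<inter> P i \<noteq> {}} \<le> 2"
    using X0(1) X1(1) by (intro exI[of _ "X0 \<inter> X1"]) (simp add: eventually_conj_iff)
qed

end

section \<open>Existence of the blocks, and conclusion\<close>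

text \<open>Recursion on \<open>n\<close>: the earlier blocks are finite, hence bounded by some
  \<open>M\<close>, and the infinite set \<open>{2 ^ Suc M..}\<close> contains an
  \<open>n\<close>-large finite set.\<close>

lemma ex_block_sequence:
  assumes "selective U"
  shows "\<exists>I. block_sequence U I"
proof -
  define P where "P f n B \<longleftrightarrow> large n B \<and> (\<forall>m<n. \<forall>x\<in>f m. \<forall>y\<in>B. 2 ^ Suc x \<le> y)"
    for f :: "nat \<Rightarrow> nat set" and n B
  have "\<exists>I. \<forall>n. P I n (I n)"
  proof (rule dependent_wellorder_choice)
    show "P f n B = P g n B" if "\<And>m. m < n \<Longrightarrow> f m = g m" for f g n B
      using that by (simp add: P_def)
    show "\<exists>B. P f n B" if "\<And>m. m < n \<Longrightarrow> P f m (f m)" for n f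
    proof -
      have "finite (\<Union>m<n. f m)"
        using that large_finite unfolding P_def by blast
      then obtain M where M: "\<And>x. x \<in> (\<Union>m<n. f m) \<Longrightarrow> x \<le> M"
        by (meson finite_nat_set_iff_bounded_le)
      obtain B where B: "B \<subseteq> {2 ^ Suc M..}" "large n B"
        using infinite_imp_large_subset[OF infinite_Ici] by blast
      have "2 ^ Suc x \<le> y" if "m < n" "x \<in> f m" "y \<in> B" for m x y
      proof -
        have "(2::nat) ^ Suc x \<le> 2 ^ Suc M"
          using M[of x] that by (intro power_increasing) auto
        then show ?thesis
          by (rule order_trans) (use B(1) that(3) in auto)
      qed
      then show ?thesis
        using B(2) unfolding P_def by blast
    qed
  qed
  then obtain I where I: "\<And>n. P I n (I n)"
    by blast
  have "block_sequence U I"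
    using I assms unfolding P_def by unfold_locales blast+
  then show ?thesis
    by (rule exI[of _ I])
qed

theorem theorem2p1:
  fixes U :: "nat filter"
  assumes "Continuum_Hypothesis"
    and "selective U"
  shows "\<exists>V :: nat filter. quasi_selective V \<and> \<not> selective V \<and>
           rudin_keisler_above V U \<and> partition_relation_2_3 V"
proof -
  obtain I where "block_sequence U I"
    using ex_block_sequence[OF assms(2)] by blast
  then interpret block_sequence U I .
  obtain G where "\<And>c. big (G c)" "\<And>c. block_homogeneous c (G c)" "\<And>c d. almost_subset (G c) (G d) \<or> almost_subset (G d) (G c)"
    using ex_tower[OF assms(1)] by blast
  then interpret tower U I G
    by unfold_locales
  show ?thesis
    using quasi_selective_V not_selective_V rudin_keisler_above_V partition_relation_V by blast
qed

end
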